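(* Let $w$ be an admissible coupling weight function on $\mathbb{G}\times\mathbb{G}$, and let $A=[a_{ij}]_{i,j\in\mathbb{G}}$ be a matrix with finite $\mathcal{S}_{0,1}$-measure, $\|A\|_{\mathcal{S}_{0,1}(\mathbb{G})}<\infty$, and bounded entries in the sense that $\|A\|_{\mathcal{S}_{\infty,w}(\mathbb{G})}<\infty$. Then $$\lim_{q\to 0}\ \|A\|_{\mathcal{S}_{q,w}(\mathbb{G})}^q=\|A\|_{\mathcal{S}_{0,1}(\mathbb{G})}.$$
   Context: $\mathbb{G}\subset\mathbb{Z}^d$ ($d\ge 1$) is the discrete spatial domain. For a vector $x=[x_i]_{i\in\mathbb{G}}$, $\|x\|_{\ell^0(\mathbb{G})}$ is the number of nonzero entries. For a matrix $A=[a_{ij}]_{i,j\in\mathbb{G}}$ with rows $a_{i\cdot}$ and columns $a_{\cdot j}$, $$\|A\|_{\mathcal{S}_{0,1}(\mathbb{G})}=\max\Big\{\sup_{i\in\mathbb{G}}\|a_{i\cdot}\|_{\ell^0(\mathbb{G})},\ \sup_{j\in\mathbb{G}}\|a_{\cdot j}\|_{\ell^0(\mathbb{G})}\Big\},\qquad \|A\|_{\mathcal{S}_{\infty,w}(\mathbb{G})}=\sup_{i,j\in\mathbb{G}}|a_{ij}|w(i,j),$$ and for $0<q<\infty$ $$\|A\|_{\mathcal{S}_{q,w}(\mathbb{G})}=\max\Big\{\sup_{i}\Big(\sum_{j}|a_{ij}|^q w(i,j)^q\Big)^{1/q},\ \sup_{j}\Big(\sum_{i}|a_{ij}|^q w(i,j)^q\Big)^{1/q}\Big\}.$$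 A quasi-distance function is $\rho:\mathbb{G}\times\mathbb{G}\to\mathbb{R}$ with $\rho(i,j)\ge 0$, $\rho(i,j)=0$ iff $i=j$, and $\rho(i,j)=\rho(j,i)$. A coupling weight function is a positive function $w$ on $\mathbb{G}\times\mathbb{G}$ with $w(i,j)\ge 1$, $w(i,j)=w(j,i)$ for all $i,j$, and $\sup_i w(i,i)<\infty$. Given a quasi-distance function $\rho$ and $0<q\le 1$, $w$ is admissible for the exponent $q$ if there exist a companion weight function $u$ (itself a coupling weight function), $\theta\in(0,1)$ and $D>0$ such that $w(i,j)\le w(i,k)u(k,j)+u(i,k)w(k,j)$ for all $i,j,k\in\mathbb{G}$, and for all $t\ge 1$ $$\sup_{i\in\mathbb{G}}\inf_{\tau\ge 0}\left\{\Big[\sum_{j\in\mathbb{G},\,\rho(i,j)<\tau}|u(i,j)|^{\frac{2q}{2-q}}\Big]^{1-\frac q2}+t\sup_{j\in\mathbb{G},\,\rho(i,j)\ge\tau}\Big(\frac{u(i,j)}{w(i,j)}\Big)^q\right\}\le D\,t^{1-\theta}.$$ Here "admissible" means admissible for every exponent $q\in(0,1]$, so that $\mathcal{S}_{q,w}$ is defined for all these $q$. *)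

theory Defs
  imports "HOL-Analysis.Analysis"
begin

text \<open>
  The index domain is an arbitrary subset \<open>G\<close> of \<open>int ^ 'd\<close>. Vectors, matrices and weights are total
  functions on \<open>int ^ 'd\<close>, of which only the values on \<open>G\<close> are ever used. All measures take values in
  \<open>ennreal\<close>, so that suprema and sums over infinite domains have their usual meaning, including the
  value \<open>\<infinity>\<close>, and the supremum over an empty set is \<open>0\<close>.
\<close>

text \<open>Real powers of extended nonnegative reals; only used for positive exponents.\<close>

definition epowr :: "ennreal \<Rightarrow> real \<Rightarrow> ennreal" where
  "epowr x p = (if x = \<infinity> then \<infinity> else ennreal (enn2real x powr p))"

text \<open>\<open>emeasure (count_space G)\<close> is the cardinality on finite subsets of \<open>G\<close> and \<open>\<infinity>\<close> on infinite ones.\<close>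

definition ell0 :: "'i set \<Rightarrow> ('i \<Rightarrow> complex) \<Rightarrow> ennreal" where
  "ell0 G x = emeasure (count_space G) {i \<in> G. x i \<noteq> 0}"

definition schur_0_1 :: "'i set \<Rightarrow> ('i \<Rightarrow> 'i \<Rightarrow> complex) \<Rightarrow> ennreal" where
  "schur_0_1 G A = max (SUP i\<in>G. ell0 G (\<lambda>j. A i j)) (SUP j\<in>G. ell0 G (\<lambda>i. A i j))"

definition schur_inf :: "'i set \<Rightarrow> ('i \<Rightarrow> 'i \<Rightarrow> real) \<Rightarrow> ('i \<Rightarrow> 'i \<Rightarrow> complex) \<Rightarrow> ennreal" where
  "schur_inf G w A = (SUP i\<in>G. SUP j\<in>G. ennreal (norm (A i j) * w i j))"

definition schur :: "'i set \<Rightarrow> real \<Rightarrow> ('i \<Rightarrow> 'i \<Rightarrow> real) \<Rightarrow> ('i \<Rightarrow> 'i \<Rightarrow> complex) \<Rightarrow> ennreal" where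
  "schur G q w A = max
     (SUP i\<in>G. epowr (\<Sum>\<^sub>\<infinity>j\<in>G. ennreal (norm (A i j) powr q * w i j powr q)) (1 / q))
     (SUP j\<in>G. epowr (\<Sum>\<^sub>\<infinity>i\<in>G. ennreal (norm (A i j) powr q * w i j powr q)) (1 / q))"

definition quasi_distance :: "'i set \<Rightarrow> ('i \<Rightarrow> 'i \<Rightarrow> real) \<Rightarrow> bool" where
  "quasi_distance G \<rho> \<longleftrightarrow>
     (\<forall>i\<in>G. \<forall>j\<in>G. \<rho> i j \<ge> 0 \<and> (\<rho> i j = 0 \<longleftrightarrow> i = j) \<and> \<rho> i j = \<rho> j i)"

definition coupling_weight :: "'i set \<Rightarrow> ('i \<Rightarrow> 'i \<Rightarrow> real) \<Rightarrow> bool" where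
  "coupling_weight G w \<longleftrightarrow>
     (\<forall>i\<in>G. \<forall>j\<in>G. w i j \<ge> 1 \<and> w i j = w j i) \<and> bdd_above ((\<lambda>i. w i i) ` G)"

definition admissible_for ::
  "'i set \<Rightarrow> ('i \<Rightarrow> 'i \<Rightarrow> real) \<Rightarrow> ('i \<Rightarrow> 'i \<Rightarrow> real) \<Rightarrow> real \<Rightarrow> bool" where
  "admissible_for G \<rho> w q \<longleftrightarrow>
     (\<exists>u \<theta> D. coupling_weight G u \<and> 0 < \<theta> \<and> \<theta> < 1 \<and> 0 < D \<and>
        (\<forall>i\<in>G. \<forall>j\<in>G. \<forall>k\<in>G. w i j \<le> w i k * u k j + u i k * w k j) \<and>
        (\<forall>t\<ge>1. (SUP i\<in>G. INF \<tau>\<in>{0::real..}.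
             epowr (\<Sum>\<^sub>\<infinity>j\<in>{j\<in>G. \<rho> i j < \<tau>}. ennreal (\<bar>u i j\<bar> powr (2 * q / (2 - q)))) (1 - q / 2)
             + ennreal t * (SUP j\<in>{j\<in>G. \<rho> i j \<ge> \<tau>}. ennreal ((u i j / w i j) powr q)))
           \<le> ennreal (D * t powr (1 - \<theta>))))"

text \<open>The companion weight, \<open>\<theta>\<close> and \<open>D\<close> may depend on the exponent.\<close>

definition admissible_weight ::
  "'i set \<Rightarrow> ('i \<Rightarrow> 'i \<Rightarrow> real) \<Rightarrow> ('i \<Rightarrow> 'i \<Rightarrow> real) \<Rightarrow> bool" where
  "admissible_weight G \<rho> w \<longleftrightarrow>
     coupling_weight G w \<and> (\<forall>q. 0 < q \<and> q \<le> 1 \<longrightarrow> admissible_for G \<rho> w q)"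

end

(* For each row or column, the finitely many nonzero terms of the q-th power sum tend to 1 as
   q tends to 0, so every number below the 0,1-measure is eventually exceeded by the sum along a
   suitable row or column. In the other direction the q-th power of the q-measure is at most M^q
   times the 0,1-measure, where M is the S_{infinity,w}-measure. *)

theory Submission
  imports Defs
begin

lemma epowr_mono:
  assumes "0 \<le> p" "x \<le> y"
  shows "epowr x p \<le> epowr y p"
proof (cases "y = \<infinity>")
  case True
  then show ?thesis by (simp add: epowr_def)
next
  case False
  then have "x \<noteq> \<infinity>" "enn2real x \<le> enn2real y"
    using assms(2) by (auto simp: top_unique less_top[symmetric] intro!: enn2real_mono)
  then show ?thesis
    using False assms(1) by (auto simp: epowr_def intro!: ennreal_leI powr_mono2)
qed

text \<open>Both exponents are positive, so \<infinity> is fixed and the finite case is the usual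
  power law. This cancels the outer root in \<open>schur\<close>, so that estimates of its q-th
  power become estimates of plain sums.\<close>

lemma epowr_epowr_inverse:
  assumes "0 < p"
  shows "epowr (epowr x (1 / p)) p = x"
  using assms by (cases x) (auto simp: epowr_def powr_powr)

text \<open>Off the support the factor \<open>0 powr q\<close> is \<open>0\<close>, so only finitely
  many terms survive and the infinite sum becomes a real one, open to real analysis.\<close>

lemma infsum_powr_eq_sum_support:
  fixes x :: "'i \<Rightarrow> complex" and v :: "'i \<Rightarrow> real"
  assumes "finite {j \<in> G. x j \<noteq> 0}" "\<And>j. j \<in> G \<Longrightarrow> 0 \<le> v j"
  shows "(\<Sum>\<^sub>\<infinity>j\<in>G. ennreal (norm (x j) powr q * v j powr q))
    = ennreal (\<Sum>j\<in>{j \<in> G. x j \<noteq> 0}. (norm (x j) * v j) powr q)"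
proof -
  have "(\<Sum>\<^sub>\<infinity>j\<in>G. ennreal (norm (x j) powr q * v j powr q))
    = (\<Sum>\<^sub>\<infinity>j\<in>{j \<in> G. x j \<noteq> 0}. ennreal ((norm (x j) * v j) powr q))"
    by (rule infsum_cong_neutral) (auto simp: powr_mult assms(2))
  also have "\<dots> = (\<Sum>j\<in>{j \<in> G. x j \<noteq> 0}. ennreal ((norm (x j) * v j) powr q))"
    using assms(1) by (rule infsum_finite)
  also have "\<dots> = ennreal (\<Sum>j\<in>{j \<in> G. x j \<noteq> 0}. (norm (x j) * v j) powr q)"
    by (rule sum_ennreal) simp
  finally show ?thesis .
qed

lemma finite_support_if_ell0_finite:
  assumes "ell0 G x < \<infinity>"
  shows "finite {j \<in> G. x j \<noteq> 0}"
proof (rule ccontr)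
  assume "infinite {j \<in> G. x j \<noteq> 0}"
  then have "ell0 G x = \<infinity>"
    unfolding ell0_def by (intro emeasure_count_space_infinite) auto
  with assms show False by simp
qed

lemma ell0_eq_card:
  assumes "finite {j \<in> G. x j \<noteq> 0}"
  shows "ell0 G x = ennreal (card {j \<in> G. x j \<noteq> 0})"
  using assms by (simp add: ell0_def emeasure_count_space ennreal_of_nat_eq_real_of_nat)

text \<open>Each nonzero term is at most \<open>M powr q\<close>, since powers with exponent
  \<open>q \<ge> 0\<close> are monotone in the base, and \<open>ell0 G x\<close> counts these
  terms.\<close>

lemma infsum_powr_le_ell0:
  fixes x :: "'i \<Rightarrow> complex" and v :: "'i \<Rightarrow> real"
  assumes "ell0 G x < \<infinity>" "0 \<le> q"
    and "\<And>j. j \<in> G \<Longrightarrow> 0 \<le> v j"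
    and "\<And>j. j \<in> G \<Longrightarrow> norm (x j) * v j \<le> M"
  shows "(\<Sum>\<^sub>\<infinity>j\<in>G. ennreal (norm (x j) powr q * v j powr q)) \<le> ell0 G x * ennreal (M powr q)"
proof -
  note fin = finite_support_if_ell0_finite[OF assms(1)]
  have "(\<Sum>j\<in>{j \<in> G. x j \<noteq> 0}. (norm (x j) * v j) powr q) \<le> card {j \<in> G. x j \<noteq> 0} * (M powr q)"
    by (rule sum_bounded_above) (auto intro!: powr_mono2 mult_nonneg_nonneg assms)
  then show ?thesis
    using fin assms(3)
    by (simp add: infsum_powr_eq_sum_support ell0_eq_card flip: ennreal_mult)
qed

text \<open>On the finite support every base is positive, so each term tends to \<open>1\<close> and
  the limit passes through the finite sum.\<close>

lemma tendsto_infsum_powr_ell0: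
  fixes x :: "'i \<Rightarrow> complex" and v :: "'i \<Rightarrow> real"
  assumes "ell0 G x < \<infinity>" "\<And>j. j \<in> G \<Longrightarrow> 0 < v j"
  shows "((\<lambda>q. \<Sum>\<^sub>\<infinity>j\<in>G. ennreal (norm (x j) powr q * v j powr q)) \<longlongrightarrow> ell0 G x) (at_right 0)"
proof -
  note fin = finite_support_if_ell0_finite[OF assms(1)]
  have "((\<lambda>q. \<Sum>j\<in>{j \<in> G. x j \<noteq> 0}. (norm (x j) * v j) powr q)
      \<longlongrightarrow> (\<Sum>j\<in>{j \<in> G. x j \<noteq> 0}. (norm (x j) * v j) powr 0)) (at_right 0)"
    using assms(2) by (intro tendsto_sum tendsto_powr tendsto_const tendsto_ident_at) force
  \<comment> \<open>Since \<open>0 powr 0 = 0\<close>, the value \<open>1\<close> relies on the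
    bases being nonzero, which the support and the positivity of \<open>v\<close> provide.\<close>
  moreover have "(\<Sum>j\<in>{j \<in> G. x j \<noteq> 0}. (norm (x j) * v j) powr 0)
      = (\<Sum>j\<in>{j \<in> G. x j \<noteq> 0}. 1)"
    using assms(2) by (intro sum.cong) force+
  ultimately show ?thesis
    using fin assms(2)
    by (simp add: infsum_powr_eq_sum_support less_imp_le ell0_eq_card tendsto_ennrealI)
qed

lemma ell0_row_le_schur_0_1: "i \<in> G \<Longrightarrow> ell0 G (\<lambda>j. A i j) \<le> schur_0_1 G A"
  and ell0_col_le_schur_0_1: "j \<in> G \<Longrightarrow> ell0 G (\<lambda>i. A i j) \<le> schur_0_1 G A"
  unfolding schur_0_1_def
  by (rule max.coboundedI1, rule SUP_upper, assumption)
    (rule max.coboundedI2, rule SUP_upper, assumption)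

text \<open>The root of a single row sum lies below the supremum; raising to the power
  \<open>q\<close> removes the root. This and its column version feed the lower bound for the
  limit.\<close>

lemma row_sum_le_epowr_schur:
  assumes "0 < q" "i \<in> G"
  shows "(\<Sum>\<^sub>\<infinity>j\<in>G. ennreal (norm (A i j) powr q * w i j powr q)) \<le> epowr (schur G q w A) q"
proof -
  have "epowr (\<Sum>\<^sub>\<infinity>j\<in>G. ennreal (norm (A i j) powr q * w i j powr q)) (1 / q) \<le> schur G q w A"
    unfolding schur_def using assms(2) by (intro max.coboundedI1 SUP_upper)
  from epowr_mono[OF less_imp_le[OF assms(1)] this] show ?thesis
    using assms(1) by (simp add: epowr_epowr_inverse)
qed

lemma col_sum_le_epowr_schur:
  assumes "0 < q" "j \<in> G"
  shows "(\<Sum>\<^sub>\<infinity>i\<in>G. ennreal (norm (A i j) powr q * w i j powr q)) \<le> epowr (schur G q w A) q"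
proof -
  have "epowr (\<Sum>\<^sub>\<infinity>i\<in>G. ennreal (norm (A i j) powr q * w i j powr q)) (1 / q) \<le> schur G q w A"
    unfolding schur_def using assms(2) by (intro max.coboundedI2 SUP_upper)
  from epowr_mono[OF less_imp_le[OF assms(1)] this] show ?thesis
    using assms(1) by (simp add: epowr_epowr_inverse)
qed

text \<open>A common bound \<open>b\<close> on the sums passes through the monotone root and the
  suprema, and the outer power then undoes the root on \<open>b\<close>.\<close>

lemma epowr_schur_le:
  assumes "0 < q"
    and "\<And>i. i \<in> G \<Longrightarrow> (\<Sum>\<^sub>\<infinity>j\<in>G. ennreal (norm (A i j) powr q * w i j powr q)) \<le> b"
    and "\<And>j. j \<in> G \<Longrightarrow> (\<Sum>\<^sub>\<infinity>i\<in>G. ennreal (norm (A i j) powr q * w i j powr q)) \<le> b"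
  shows "epowr (schur G q w A) q \<le> b"
proof -
  have "schur G q w A \<le> epowr b (1 / q)"
    unfolding schur_def using assms by (intro max.boundedI SUP_least epowr_mono) auto
  from epowr_mono[OF less_imp_le[OF assms(1)] this] show ?thesis
    using assms(1) by (simp add: epowr_epowr_inverse)
qed

lemma epowr_schur_le_schur_0_1:
  assumes "0 < q" "schur_0_1 G A < \<infinity>"
    and "\<And>i j. i \<in> G \<Longrightarrow> j \<in> G \<Longrightarrow> 0 \<le> w i j"
    and "\<And>i j. i \<in> G \<Longrightarrow> j \<in> G \<Longrightarrow> norm (A i j) * w i j \<le> M"
  shows "epowr (schur G q w A) q \<le> schur_0_1 G A * ennreal (M powr q)"
proof (rule epowr_schur_le[OF assms(1)])
  fix i assume "i \<in> G"
  then have le: "ell0 G (\<lambda>j. A i j) \<le> schur_0_1 G A" by (rule ell0_row_le_schur_0_1)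
  then have "(\<Sum>\<^sub>\<infinity>j\<in>G. ennreal (norm (A i j) powr q * w i j powr q))
      \<le> ell0 G (\<lambda>j. A i j) * ennreal (M powr q)"
    using assms \<open>i \<in> G\<close> by (intro infsum_powr_le_ell0) auto
  also have "\<dots> \<le> schur_0_1 G A * ennreal (M powr q)"
    using le by (intro mult_right_mono) auto
  finally show "(\<Sum>\<^sub>\<infinity>j\<in>G. ennreal (norm (A i j) powr q * w i j powr q))
      \<le> schur_0_1 G A * ennreal (M powr q)" .
next
  fix j assume "j \<in> G"
  then have le: "ell0 G (\<lambda>i. A i j) \<le> schur_0_1 G A" by (rule ell0_col_le_schur_0_1)
  then have "(\<Sum>\<^sub>\<infinity>i\<in>G. ennreal (norm (A i j) powr q * w i j powr q))
      \<le> ell0 G (\<lambda>i. A i j) * ennreal (M powr q)"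
    using assms \<open>j \<in> G\<close> by (intro infsum_powr_le_ell0) auto
  also have "\<dots> \<le> schur_0_1 G A * ennreal (M powr q)"
    using le by (intro mult_right_mono) auto
  finally show "(\<Sum>\<^sub>\<infinity>i\<in>G. ennreal (norm (A i j) powr q * w i j powr q))
      \<le> schur_0_1 G A * ennreal (M powr q)" .
qed

lemma norm_mult_weight_le_schur_inf:
  assumes "schur_inf G w A < \<infinity>" "i \<in> G" "j \<in> G"
  shows "norm (A i j) * w i j \<le> enn2real (schur_inf G w A)"
proof -
  have "ennreal (norm (A i j) * w i j) \<le> schur_inf G w A"
    unfolding schur_inf_def using assms(2,3) by (intro SUP_upper2[of i] SUP_upper)
  also have "\<dots> = ennreal (enn2real (schur_inf G w A))"
    using assms(1) by simp
  finally show ?thesis by simp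
qed

lemma eventually_less_epowr_schur:
  assumes "schur_0_1 G A < \<infinity>" "\<And>i j. i \<in> G \<Longrightarrow> j \<in> G \<Longrightarrow> 0 < w i j" "a < schur_0_1 G A"
  shows "\<forall>\<^sub>F q in at_right 0. a < epowr (schur G q w A) q"
proof -
  have pos: "\<forall>\<^sub>F q in at_right 0. (0::real) < q"
    by (simp add: eventually_at_right_less)
  \<comment> \<open>A strict bound below a maximum of suprema is already witnessed by one row or
    column. It is fixed before \<open>q\<close> varies, so convergence along that line suffices and
    no uniformity over \<open>G\<close> is required.\<close>
  consider i where "i \<in> G" "a < ell0 G (\<lambda>j. A i j)" | j where "j \<in> G" "a < ell0 G (\<lambda>i. A i j)"
    using assms(3) unfolding schur_0_1_def less_max_iff_disj less_SUP_iff by (elim disjE bexE)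
  then show ?thesis
  proof cases
    case 1
    then have "ell0 G (\<lambda>j. A i j) < \<infinity>"
      using le_less_trans[OF ell0_row_le_schur_0_1 assms(1)] by simp
    then have "((\<lambda>q. \<Sum>\<^sub>\<infinity>j\<in>G. ennreal (norm (A i j) powr q * w i j powr q))
        \<longlongrightarrow> ell0 G (\<lambda>j. A i j)) (at_right 0)"
      using assms(2) 1(1) by (intro tendsto_infsum_powr_ell0) auto
    from order_tendstoD(1)[OF this 1(2)] pos show ?thesis
      by eventually_elim (rule less_le_trans[OF _ row_sum_le_epowr_schur[OF _ 1(1)]])
  next
    case 2
    then have "ell0 G (\<lambda>i. A i j) < \<infinity>"
      using le_less_trans[OF ell0_col_le_schur_0_1 assms(1)] by simp
    then have "((\<lambda>q. \<Sum>\<^sub>\<infinity>i\<in>G. ennreal (norm (A i j) powr q * w i j powr q))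
        \<longlongrightarrow> ell0 G (\<lambda>i. A i j)) (at_right 0)"
      using assms(2) 2(1) by (intro tendsto_infsum_powr_ell0) auto
    from order_tendstoD(1)[OF this 2(2)] pos show ?thesis
      by eventually_elim (rule less_le_trans[OF _ col_sum_le_epowr_schur[OF _ 2(1)]])
  qed
qed

theorem theorem5p1:
  fixes G :: "(int ^ 'd) set"
    and \<rho> w :: "int ^ 'd \<Rightarrow> int ^ 'd \<Rightarrow> real"
    and A :: "int ^ 'd \<Rightarrow> int ^ 'd \<Rightarrow> complex"
  assumes "quasi_distance G \<rho>"
    and "admissible_weight G \<rho> w"
    and "schur_0_1 G A < \<infinity>"
    and "schur_inf G w A < \<infinity>"
  shows "((\<lambda>q. epowr (schur G q w A) q) \<longlongrightarrow> schur_0_1 G A) (at_right 0)"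
proof (rule order_tendstoI)
  \<comment> \<open>Coupling weights are at least \<open>1\<close>, hence positive.\<close>
  have w_pos: "0 < w i j" if "i \<in> G" "j \<in> G" for i j
    using assms(2) that unfolding admissible_weight_def coupling_weight_def by force
  fix a assume "a < schur_0_1 G A"
  with w_pos show "\<forall>\<^sub>F q in at_right 0. a < epowr (schur G q w A) q"
    using assms(3) by (intro eventually_less_epowr_schur)
next
  have w_nonneg: "0 \<le> w i j" if "i \<in> G" "j \<in> G" for i j
    using assms(2) that unfolding admissible_weight_def coupling_weight_def by force
  fix a assume a: "schur_0_1 G A < a"
  \<comment> \<open>\<open>0 powr q = 0\<close>, so the limit of \<open>M powr q\<close> needs a positive bound \<open>M\<close>.\<close>
  define M where "M = enn2real (schur_inf G w A) + 1"
  have "M > 0" by (simp add: M_def add_nonneg_pos)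
  then have "((\<lambda>q. M powr q) \<longlongrightarrow> M powr 0) (at_right 0)"
    by (intro tendsto_powr tendsto_const tendsto_ident_at) simp
  then have "((\<lambda>q. ennreal (M powr q)) \<longlongrightarrow> 1) (at_right 0)"
    using \<open>M > 0\<close> tendsto_ennrealI by fastforce
  then have "((\<lambda>q. schur_0_1 G A * ennreal (M powr q)) \<longlongrightarrow> schur_0_1 G A * 1) (at_right 0)"
    \<comment> \<open>Multiplication by a constant preserves this limit in \<open>ennreal\<close>
      because the constant is finite.\<close>
    using assms(3) by (intro ennreal_tendsto_cmult) auto
  then have "\<forall>\<^sub>F q in at_right 0. schur_0_1 G A * ennreal (M powr q) < a"
    using order_tendstoD(2) a by fastforce
  moreover have "\<forall>\<^sub>F q in at_right 0. (0::real) < q"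
    by (simp add: eventually_at_right_less)
  ultimately show "\<forall>\<^sub>F q in at_right 0. epowr (schur G q w A) q < a"
  proof eventually_elim
    case (elim q)
    \<comment> \<open>Adding \<open>1\<close> to the supremum only weakens the entrywise bound, so
      \<open>M\<close> still dominates all weighted entries.\<close>
    have "norm (A i j) * w i j \<le> M" if "i \<in> G" "j \<in> G" for i j
      using norm_mult_weight_le_schur_inf[OF assms(4) that] by (simp add: M_def)
    with w_nonneg have "epowr (schur G q w A) q \<le> schur_0_1 G A * ennreal (M powr q)"
      using elim(2) assms(3) by (intro epowr_schur_le_schur_0_1) auto
    with elim(1) show ?case by (rule le_less_trans[rotated])
  qed
qed

end
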